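(* Let $\mathbb{K}$ be a field of characteristic $0$ and let $(A,\mu)$ be a commutative weakly associative $\mathbb{K}$-algebra. Let $\mu_t=\mu+t\varphi_1+t^2\varphi_2+\cdots$ be any weakly associative formal deformation of $\mu$. Let $\psi_{\varphi_1}(X,Y)=\varphi_1(X,Y)-\varphi_1(Y,X)$ be the skew-symmetric part of $\varphi_1$. Then $(A,\mu,\psi_{\varphi_1})$ is a nonassociative Poisson algebra. (The algebra $(A[[t]],\mu_t)$ is then called a quantization of the nonassociative Poisson algebra $(A,\mu,\psi_{\varphi_1})$.)
   Context: A $\mathbb{K}$-algebra is a $\mathbb{K}$-vector space with a bilinear multiplication (not assumed associative). The associator of a multiplication $\ast$ is $\mathcal{A}_\ast(X,Y,Z)=X\ast(Y\ast Z)-(X\ast Y)\ast Z$. The algebra $(A,\ast)$ is weakly associative if $\mathcal{A}_\ast(X,Y,Z)+\mathcal{A}_\ast(Y,Z,X)-\mathcal{A}_\ast(Y,X,Z)=0$ for all $X,Y,Z\in A$. A weakly associative formal deformation of $(A,\mu)$ is a bilinear map $\mu_t:A\otimes A\to A[[t]]$ of the form $\mu_t=\mu+t\varphi_1+t^2\varphi_2+\cdots$, with each $\varphi_i:A\otimes A\to A$ bilinear, whose $\mathbb{K}[[t]]$-bilinear extension to $A[[t]]$ makes $A[[t]]$ a weakly associative $\mathbb{K}[[t]]$-algebra. A nonassociative Poisson algebra is a triple $(P,\bullet,\{,\})$ where $P$ is a $\mathbb{K}$-vector space, $\bullet$ is a commutative (not necessarily associative) bilinear multiplication, $\{,\}$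 is a Lie bracket on $P$, and the Leibniz identity $\{X\bullet Y,Z\}=X\bullet\{Y,Z\}+\{X,Z\}\bullet Y$ holds for all $X,Y,Z\in P$. *)

theory Defs
  imports "HOL-Computational_Algebra.Formal_Power_Series"
begin

text \<open>
  Modules are given, as in HOL's \<open>Modules\<close> and \<open>Vector_Spaces\<close>, by a scalar action on an additive
  group type. The ground ring is an arbitrary commutative ring, so that the same notions apply to
  a vector space \<open>A\<close> over a field \<open>K\<close> and to \<open>A[[t]]\<close> over \<open>K[[t]]\<close>; over a field, \<open>module\<close>
  is equivalent to \<open>vector_space\<close> (see \<open>module_iff_vector_space\<close>).
\<close>

definition bilinear_mult ::
  "('k::comm_ring_1 \<Rightarrow> 'a::ab_group_add \<Rightarrow> 'a) \<Rightarrow> ('a \<Rightarrow> 'a \<Rightarrow> 'a) \<Rightarrow> bool" where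
  "bilinear_mult s m \<longleftrightarrow>
     (\<forall>x. module_hom s s (\<lambda>y. m x y)) \<and> (\<forall>y. module_hom s s (\<lambda>x. m x y))"

definition nonassoc_algebra ::
  "('k::comm_ring_1 \<Rightarrow> 'a::ab_group_add \<Rightarrow> 'a) \<Rightarrow> ('a \<Rightarrow> 'a \<Rightarrow> 'a) \<Rightarrow> bool" where
  "nonassoc_algebra s m \<longleftrightarrow> module s \<and> bilinear_mult s m"

definition associator :: "('a::ab_group_add \<Rightarrow> 'a \<Rightarrow> 'a) \<Rightarrow> 'a \<Rightarrow> 'a \<Rightarrow> 'a \<Rightarrow> 'a" where
  "associator m x y z = m x (m y z) - m (m x y) z"

definition weakly_associative_algebra ::
  "('k::comm_ring_1 \<Rightarrow> 'a::ab_group_add \<Rightarrow> 'a) \<Rightarrow> ('a \<Rightarrow> 'a \<Rightarrow> 'a) \<Rightarrow> bool" where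
  "weakly_associative_algebra s m \<longleftrightarrow>
     nonassoc_algebra s m \<and>
     (\<forall>x y z. associator m x y z + associator m y z x - associator m y x z = 0)"

definition commutative_mult :: "('a \<Rightarrow> 'a \<Rightarrow> 'a) \<Rightarrow> bool" where
  "commutative_mult m \<longleftrightarrow> (\<forall>x y. m x y = m y x)"

definition lie_bracket ::
  "('k::comm_ring_1 \<Rightarrow> 'a::ab_group_add \<Rightarrow> 'a) \<Rightarrow> ('a \<Rightarrow> 'a \<Rightarrow> 'a) \<Rightarrow> bool" where
  "lie_bracket s b \<longleftrightarrow>
     bilinear_mult s b \<and>
     (\<forall>x. b x x = 0) \<and>
     (\<forall>x y z. b x (b y z) + b y (b z x) + b z (b x y) = 0)"

definition nonassoc_poisson_algebra ::
  "('k::field \<Rightarrow> 'a::ab_group_add \<Rightarrow> 'a) \<Rightarrow> ('a \<Rightarrow> 'a \<Rightarrow> 'a) \<Rightarrow> ('a \<Rightarrow> 'a \<Rightarrow> 'a) \<Rightarrow> bool" where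
  "nonassoc_poisson_algebra s m b \<longleftrightarrow>
     vector_space s \<and>
     bilinear_mult s m \<and> commutative_mult m \<and>
     lie_bracket s b \<and>
     (\<forall>x y z. b (m x y) z = m x (b y z) + m (b x z) y)"

definition skew_part :: "('a::ab_group_add \<Rightarrow> 'a \<Rightarrow> 'a) \<Rightarrow> 'a \<Rightarrow> 'a \<Rightarrow> 'a" where
  "skew_part f x y = f x y - f y x"

text \<open>
  \<open>A[[t]]\<close> is the type \<open>'a fps\<close> with its library addition; the next definition is the action of
  \<open>K[[t]]\<close> on it.
\<close>

definition fps_scale ::
  "('k::comm_ring_1 \<Rightarrow> 'a::ab_group_add \<Rightarrow> 'a) \<Rightarrow> 'k fps \<Rightarrow> 'a fps \<Rightarrow> 'a fps" where
  "fps_scale s r f = Abs_fps (\<lambda>n. \<Sum>i=0..n. s (fps_nth r i) (fps_nth f (n - i)))"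

text \<open>
  The \<open>K[[t]]\<close>-bilinear extension of \<open>\<mu>\<^sub>t = \<Sum>\<^sub>k t\<^sup>k \<phi>\<^sub>k\<close>, where \<open>\<phi>\<^sub>k x y = fps_nth (\<mu>\<^sub>t x y) k\<close>: its
  \<open>n\<close>-th coefficient at \<open>(f, g)\<close> is the sum of all \<open>\<phi>\<^sub>k f\<^sub>i g\<^sub>j\<close> with \<open>k + i + j = n\<close>. The lemmas
  \<open>bilinear_fps_extension\<close>, \<open>fps_extension_const\<close> and \<open>fps_extension_unique\<close> below show that it is
  the only \<open>K[[t]]\<close>-bilinear map on \<open>A[[t]]\<close> that restricts to \<open>\<mu>\<^sub>t\<close> on \<open>A\<close>.
\<close>

definition fps_extension ::
  "('a::ab_group_add \<Rightarrow> 'a \<Rightarrow> 'a fps) \<Rightarrow> 'a fps \<Rightarrow> 'a fps \<Rightarrow> 'a fps" where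
  "fps_extension mt f g = Abs_fps (\<lambda>n. \<Sum>k=0..n. \<Sum>i=0..n - k.
     fps_nth (mt (fps_nth f i) (fps_nth g (n - k - i))) k)"

definition weakly_associative_deformation ::
  "('k::field \<Rightarrow> 'a::ab_group_add \<Rightarrow> 'a) \<Rightarrow> ('a \<Rightarrow> 'a \<Rightarrow> 'a) \<Rightarrow> ('a \<Rightarrow> 'a \<Rightarrow> 'a fps) \<Rightarrow> bool" where
  "weakly_associative_deformation s m mt \<longleftrightarrow>
     (\<forall>x y. fps_nth (mt x y) 0 = m x y) \<and>
     (\<forall>k. bilinear_mult s (\<lambda>x y. fps_nth (mt x y) k)) \<and>
     weakly_associative_algebra (fps_scale s) (fps_extension mt)"

lemma module_fps_scale:
  assumes "module s"
  shows "module (fps_scale s)"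
proof -
  interpret module s by fact
  show ?thesis
  proof
    fix a b :: "'a fps" and x y :: "'b fps"
    show "fps_scale s a (x + y) = fps_scale s a x + fps_scale s a y"
      by (simp add: fps_eq_iff fps_scale_def scale_right_distrib sum.distrib)
    show "fps_scale s (a + b) x = fps_scale s a x + fps_scale s b x"
      by (simp add: fps_eq_iff fps_scale_def scale_left_distrib sum.distrib)
    show "fps_scale s 1 x = x"
    proof (rule fps_ext)
      fix n
      have "fps_nth (fps_scale s 1 x) n = (\<Sum>i=0..n. if i = 0 then fps_nth x n else 0)"
        unfolding fps_scale_def fps_nth_Abs_fps by (rule sum.cong) auto
      then show "fps_nth (fps_scale s 1 x) n = fps_nth x n" by simp
    qed
    show "fps_scale s a (fps_scale s b x) = fps_scale s (a * b) x"
    proof (rule fps_ext)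
      fix n
      show "fps_nth (fps_scale s a (fps_scale s b x)) n = fps_nth (fps_scale s (a * b) x) n"
        using fps_mult_assoc_lemma[where k = n and n = n and
          f = "\<lambda>i j l. s (fps_nth a i * fps_nth b j) (fps_nth x l)"]
        by (simp add: fps_scale_def fps_mult_nth scale_sum_left scale_sum_right)
    qed
  qed
qed

lemma fps_extension_flip:
  "fps_extension (\<lambda>x y. mt y x) g f = fps_extension mt f g"
proof (rule fps_ext)
  fix n
  show "fps_nth (fps_extension (\<lambda>x y. mt y x) g f) n = fps_nth (fps_extension mt f g) n"
    unfolding fps_extension_def fps_nth_Abs_fps
    by (rule sum.cong[OF refl], subst sum.atLeastAtMost_rev, rule sum.cong[OF refl]) simp
qed

lemma fps_convolution_swap:
  fixes F :: "nat \<Rightarrow> nat \<Rightarrow> nat \<Rightarrow> 'a::comm_monoid_add"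
  shows "(\<Sum>k=0..n. \<Sum>a=0..n - k. F k a (n - k - a)) = (\<Sum>a=0..n. \<Sum>k=0..n - a. F k a (n - a - k))"
proof -
  have "(\<Sum>k=0..n. \<Sum>a=0..n - k. F k a (n - k - a)) = (\<Sum>j=0..n. \<Sum>i=0..j. F i (j - i) (n - j))"
    using fps_mult_assoc_lemma[where k = n and n = n and f = F] by simp
  also have "\<dots> = (\<Sum>j=0..n. \<Sum>i=0..j. F (j - i) i (n - j))"
    by (rule sum.cong[OF refl], subst sum.atLeastAtMost_rev, rule sum.cong[OF refl]) simp
  also have "\<dots> = (\<Sum>a=0..n. \<Sum>k=0..n - a. F k a (n - a - k))"
    using fps_mult_assoc_lemma[where k = n and n = n and f = "\<lambda>a k l. F k a l"] by simp
  finally show ?thesis .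
qed

lemma fps_extension_hom_left:
  assumes "module s" and bil: "\<And>k. bilinear_mult s (\<lambda>x y. fps_nth (mt x y) k)"
  shows "module_hom (fps_scale s) (fps_scale s) (\<lambda>f. fps_extension mt f g)"
proof -
  interpret module s by fact
  interpret M: module "fps_scale s" by (rule module_fps_scale) fact
  have hom: "module_hom s s (\<lambda>x. fps_nth (mt x y) k)" for y k
    using bil[of k] by (simp add: bilinear_mult_def)
  have add: "fps_nth (mt (x + x') y) k = fps_nth (mt x y) k + fps_nth (mt x' y) k" for x x' y k
    using module_hom.add[OF hom] .
  have sc: "fps_nth (mt (s c x) y) k = s c (fps_nth (mt x y) k)" for c x y k
    using module_hom.scale[OF hom] .
  have sm: "fps_nth (mt (sum h I) y) k = (\<Sum>i\<in>I. fps_nth (mt (h i) y) k)" for h I y k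
    using module_hom.sum[OF hom] .
  show ?thesis
  proof
    fix f f' :: "'b fps" and r :: "'a fps"
    show "fps_extension mt (f + f') g = fps_extension mt f g + fps_extension mt f' g"
      by (simp add: fps_eq_iff fps_extension_def add sum.distrib)
    show "fps_extension mt (fps_scale s r f) g = fps_scale s r (fps_extension mt f g)"
    proof (rule fps_ext)
      fix n
      define G where "G k a l = (\<Sum>i=0..l.
        s (fps_nth r a) (fps_nth (mt (fps_nth f i) (fps_nth g (l - i))) k))" for k a l
      have "(\<Sum>i=0..m. fps_nth (mt (fps_nth (fps_scale s r f) i) (fps_nth g (m - i))) k)
          = (\<Sum>a=0..m. G k a (m - a))" for m k
        using fps_mult_assoc_lemma[where k = m and n = m and
          f = "\<lambda>a i l. s (fps_nth r a) (fps_nth (mt (fps_nth f i) (fps_nth g l)) k)"]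
        by (simp add: fps_scale_def sm sc G_def)
      then have "fps_nth (fps_extension mt (fps_scale s r f) g) n
          = (\<Sum>k=0..n. \<Sum>a=0..n - k. G k a (n - k - a))"
        by (simp only: fps_extension_def fps_nth_Abs_fps)
      also have "\<dots> = (\<Sum>a=0..n. \<Sum>k=0..n - a. G k a (n - a - k))"
        by (rule fps_convolution_swap)
      also have "\<dots> = fps_nth (fps_scale s r (fps_extension mt f g)) n"
        by (simp add: fps_scale_def fps_extension_def G_def scale_sum_right add.assoc)
      finally show "fps_nth (fps_extension mt (fps_scale s r f) g) n
          = fps_nth (fps_scale s r (fps_extension mt f g)) n" .
    qed
  qed
qed

lemma bilinear_fps_extension:
  assumes "module s" and bil: "\<And>k. bilinear_mult s (\<lambda>x y. fps_nth (mt x y) k)"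
  shows "bilinear_mult (fps_scale s) (fps_extension mt)"
proof -
  have "bilinear_mult s (\<lambda>x y. fps_nth (mt y x) k)" for k
    using bil[of k] by (simp add: bilinear_mult_def)
  then have "module_hom (fps_scale s) (fps_scale s) (fps_extension mt f)" for f
    using fps_extension_hom_left[of s "\<lambda>x y. mt y x" f] assms(1)
    unfolding fps_extension_flip[of mt] by simp
  then show ?thesis
    using fps_extension_hom_left[OF assms] by (simp add: bilinear_mult_def)
qed

lemma fps_extension_const:
  assumes "\<And>k. bilinear_mult s (\<lambda>x y. fps_nth (mt x y) k)"
  shows "fps_extension mt (fps_const x) (fps_const y) = mt x y"
proof (rule fps_ext)
  fix n
  have z: "fps_nth (mt 0 v) k = 0" "fps_nth (mt u 0) k = 0" for u v k
    using assms[of k] module_hom.zero by (fastforce simp: bilinear_mult_def)+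
  have "fps_nth (fps_extension mt (fps_const x) (fps_const y)) n =
      (\<Sum>k=0..n. \<Sum>i=0..n - k. if i = 0 then if k = n then fps_nth (mt x y) n else 0 else 0)"
    unfolding fps_extension_def fps_nth_Abs_fps
    by (intro sum.cong refl) (auto simp: z)
  then show "fps_nth (fps_extension mt (fps_const x) (fps_const y)) n = fps_nth (mt x y) n"
    by simp
qed

lemma fps_extension_unique:
  assumes "module s" and bil: "\<And>k. bilinear_mult s (\<lambda>x y. fps_nth (mt x y) k)"
    and F: "bilinear_mult (fps_scale s) F" "\<And>x y. F (fps_const x) (fps_const y) = mt x y"
  shows "F = fps_extension mt"
proof -
  interpret module s by fact
  define sh where "sh f = Abs_fps (\<lambda>n. fps_nth f (Suc n))" for f :: "'b fps"
  have X: "fps_nth (fps_scale s fps_X h) n = (if n = 0 then 0 else fps_nth h (n - 1))"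
    for h :: "'b fps" and n
  proof -
    have "fps_nth (fps_scale s fps_X h) n = (\<Sum>i=0..n. if i = 1 then fps_nth h (n - 1) else 0)"
      unfolding fps_scale_def fps_nth_Abs_fps by (rule sum.cong) auto
    then show ?thesis by simp
  qed
  have dec: "f = fps_const (fps_nth f 0) + fps_scale s fps_X (sh f)" for f :: "'b fps"
    by (rule fps_ext) (simp add: X sh_def)
  have rec: "fps_nth (H f g) n = fps_nth (mt (fps_nth f 0) (fps_nth g 0)) n +
      (if n = 0 then 0 else fps_nth (H (fps_const (fps_nth f 0)) (sh g)) (n - 1)
        + fps_nth (H (sh f) g) (n - 1))"
    if H: "bilinear_mult (fps_scale s) H" "\<And>x y. H (fps_const x) (fps_const y) = mt x y"
    for H f g n
  proof -
    have r: "module_hom (fps_scale s) (fps_scale s) (\<lambda>y. H x y)"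
      and l: "module_hom (fps_scale s) (fps_scale s) (\<lambda>x. H x y)" for x y
      using H(1) by (auto simp: bilinear_mult_def)
    have "H f g = H (fps_const (fps_nth f 0)) g + fps_scale s fps_X (H (sh f) g)"
      by (subst dec[of f]) (simp only: module_hom.add[OF l] module_hom.scale[OF l])
    also have "H (fps_const (fps_nth f 0)) g = mt (fps_nth f 0) (fps_nth g 0)
        + fps_scale s fps_X (H (fps_const (fps_nth f 0)) (sh g))"
      by (subst dec[of g]) (simp only: module_hom.add[OF r] module_hom.scale[OF r] H(2))
    finally show ?thesis by (simp add: X)
  qed
  note E = bilinear_fps_extension[OF assms(1) bil] fps_extension_const[OF bil]
  have "fps_nth (F f g) n = fps_nth (fps_extension mt f g) n" for f g n
  proof (induction n arbitrary: f g)
    case 0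
    show ?case by (subst rec[OF F], subst rec[OF E]) simp
  next
    case (Suc n)
    show ?case by (subst rec[OF F], subst rec[OF E]) (simp add: Suc.IH)
  qed
  then show ?thesis by (intro ext fps_ext)
qed

end

theory Submission
  imports Defs
begin

text \<open>
  Expanding the associators, weak associativity says exactly that every commutator map \<open>[x, -]\<close>
  is a derivation of the multiplication. Hence it is also a derivation of the commutator itself,
  which is the Jacobi identity. The commutator of \<open>\<mu>\<^sub>t\<close> is divisible by \<open>t\<close> because \<open>\<mu>\<close> is
  commutative, with leading coefficient \<open>\<psi>\<close>; reading the derivation property at order \<open>t\<close> and
  the Jacobi identity at order \<open>t\<^sup>2\<close> gives the Leibniz and Jacobi identities for \<open>\<psi>\<close>.
\<close>

lemma bilinear_multD:
  assumes "bilinear_mult s m"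
  shows "m (x + y) z = m x z + m y z" "m x (y + z) = m x y + m x z"
    "m (x - y) z = m x z - m y z" "m x (y - z) = m x y - m x z"
    "m 0 x = 0" "m x 0 = 0" "m (- x) y = - m x y" "m x (- y) = - m x y"
proof -
  have l: "module_hom s s (\<lambda>x. m x y)" and r: "module_hom s s (\<lambda>y. m x y)" for x y
    using assms by (auto simp: bilinear_mult_def)
  show "m (x + y) z = m x z + m y z" "m (x - y) z = m x z - m y z" "m 0 x = 0"
    "m (- x) y = - m x y"
    using module_hom.add[OF l] module_hom.diff[OF l] module_hom.zero[OF l] module_hom.neg[OF l]
    by auto
  show "m x (y + z) = m x y + m x z" "m x (y - z) = m x y - m x z" "m x 0 = 0"
    "m x (- y) = - m x y"
    using module_hom.add[OF r] module_hom.diff[OF r] module_hom.zero[OF r] module_hom.neg[OF r]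
    by auto
qed

lemma bilinear_mult_skew_part:
  assumes "module s" and "bilinear_mult s m"
  shows "bilinear_mult s (skew_part m)"
proof -
  interpret module s by fact
  have "module_hom s s (\<lambda>x. m x y)" "module_hom s s (\<lambda>y. m x y)" for x y
    using assms(2) by (auto simp: bilinear_mult_def)
  note hom = this[THEN module_hom.scale]
  show ?thesis
    unfolding bilinear_mult_def skew_part_def
    by (auto intro!: module_hom.intro module_hom_axioms.intro assms(1)
        simp: bilinear_multD[OF assms(2)] hom scale_right_diff_distrib)
qed

text \<open>The six products in the cyclic associator sum pair off, with \<open>[u, v]\<close> for
  \<open>skew_part m u v\<close>, into \<open>[x, m y z]\<close>, \<open>- m [x, y] z\<close> and
  \<open>- m y [x, z]\<close>.\<close>

lemma weakly_associative_derivation: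
  assumes "weakly_associative_algebra s m"
  shows "skew_part m x (m y z) = m (skew_part m x y) z + m y (skew_part m x z)"
proof -
  have bil: "bilinear_mult s m"
    and "associator m x y z + associator m y z x - associator m y x z = 0"
    using assms by (auto simp: weakly_associative_algebra_def nonassoc_algebra_def)
  then show ?thesis
    by (simp add: associator_def skew_part_def bilinear_multD[OF bil] algebra_simps)
qed

lemma weakly_associative_jacobi:
  fixes m :: "'a::ab_group_add \<Rightarrow> 'a \<Rightarrow> 'a"
  assumes "weakly_associative_algebra s m"
  defines "b \<equiv> skew_part m"
  shows "b x (b y z) + b y (b z x) + b z (b x y) = 0"
proof -
  have mod: "module s" and bil: "bilinear_mult s m"
    using assms by (auto simp: weakly_associative_algebra_def nonassoc_algebra_def)
  have skew: "b u v = - b v u" for u v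
    by (simp add: b_def skew_part_def)
  note bilb = bilinear_multD[OF bilinear_mult_skew_part[OF mod bil], folded b_def]
  \<comment> \<open>Only the inner bracket is expanded, so that the derivation rule for
    \<open>b x\<close> applies to both products. The four resulting terms then regroup into
    \<open>b (b x y) z\<close> and \<open>b y (b x z)\<close>.\<close>
  have "b x (b y z) = b x (m y z) - b x (m z y)"
    by (simp add: b_def skew_part_def[of m y z] bilb[unfolded b_def])
  also have "\<dots> = b (b x y) z + b y (b x z)"
    unfolding b_def weakly_associative_derivation[OF assms(1)]
    by (simp add: skew_part_def algebra_simps)
  also have "b (b x y) z = - b z (b x y)"
    by (rule skew)
  also have "b y (b x z) = - b y (b z x)"
    by (subst skew[of x z]) (simp add: bilb)
  finally show ?thesis by simp
qed

theorem proposition20: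
  fixes scale :: "'k::field_char_0 \<Rightarrow> 'a::ab_group_add \<Rightarrow> 'a"
    and \<mu> :: "'a \<Rightarrow> 'a \<Rightarrow> 'a"
    and \<mu>\<^sub>t :: "'a \<Rightarrow> 'a \<Rightarrow> 'a fps"
  assumes "vector_space scale"
    and "weakly_associative_algebra scale \<mu>"
    and "commutative_mult \<mu>"
    and "weakly_associative_deformation scale \<mu> \<mu>\<^sub>t"
  shows "nonassoc_poisson_algebra scale \<mu> (skew_part (\<lambda>x y. fps_nth (\<mu>\<^sub>t x y) 1))"
proof -
  define \<psi> where "\<psi> = skew_part (\<lambda>x y. fps_nth (\<mu>\<^sub>t x y) 1)"
  define M where "M = fps_extension \<mu>\<^sub>t"
  define B where "B = skew_part M"
  have mod: "module scale" and bil: "bilinear_mult scale \<mu>"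
    using assms(2) by (auto simp: weakly_associative_algebra_def nonassoc_algebra_def)
  have coeff0: "fps_nth (\<mu>\<^sub>t x y) 0 = \<mu> x y" for x y
    using assms(4) by (simp add: weakly_associative_deformation_def)
  have comm: "\<mu> x y = \<mu> y x" for x y
    using assms(3) unfolding commutative_mult_def by blast
  have bilt: "bilinear_mult scale (\<lambda>x y. fps_nth (\<mu>\<^sub>t x y) k)" for k
    using assms(4) by (simp add: weakly_associative_deformation_def)
  have wa: "weakly_associative_algebra (fps_scale scale) M"
    using assms(4) by (simp add: weakly_associative_deformation_def M_def)
  have bil\<psi>: "bilinear_mult scale \<psi>"
    unfolding \<psi>_def by (rule bilinear_mult_skew_part[OF mod bilt])
  have skew: "\<psi> x y = - \<psi> y x" for x y
    by (simp add: \<psi>_def skew_part_def)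
  have M_const: "M (fps_const x) (fps_const y) = \<mu>\<^sub>t x y" for x y
    unfolding M_def by (rule fps_extension_const[OF bilt])
  have M0: "fps_nth (M f g) 0 = \<mu> (fps_nth f 0) (fps_nth g 0)" for f g
    by (simp add: M_def fps_extension_def coeff0)
  have M1: "fps_nth (M f g) 1 = \<mu> (fps_nth f 0) (fps_nth g 1) + \<mu> (fps_nth f 1) (fps_nth g 0)
      + fps_nth (\<mu>\<^sub>t (fps_nth f 0) (fps_nth g 0)) 1" for f g
    by (simp add: M_def fps_extension_def coeff0)
  have B0: "fps_nth (B f g) 0 = 0" for f g
    by (simp add: B_def skew_part_def M0 comm)
  \<comment> \<open>The two \<mu>-terms of \<open>M1\<close> are together symmetric in
    \<open>f\<close> and \<open>g\<close> and cancel. The attribute \<open>simplified\<close> turns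
    the index 1 into \<open>Suc 0\<close>, the form it takes in the simplified goal.\<close>
  have B1: "fps_nth (B f g) 1 = \<psi> (fps_nth f 0) (fps_nth g 0)" for f g
    by (simp add: B_def skew_part_def M1[simplified] \<psi>_def comm algebra_simps)
  \<comment> \<open>In general the second-order coefficient of \<mu>\<open>\<^sub>t\<close> would
    enter here; it meets only the constant term of \<open>g\<close>, which vanishes. The \<mu>-terms
    cancel by commutativity.\<close>
  have B2: "fps_nth (B (fps_const x) g) 2 = \<psi> x (fps_nth g 1)" if "fps_nth g 0 = 0" for x g
    using that
    by (simp add: B_def skew_part_def M_def fps_extension_def \<psi>_def numeral_2_eq_2 coeff0 comm
        bilinear_multD[OF bil] bilinear_multD[OF bilt])
  have leibniz: "\<psi> x (\<mu> y z) = \<mu> (\<psi> x y) z + \<mu> y (\<psi> x z)" for x y z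
  proof -
    let ?x = "fps_const x" and ?y = "fps_const y" and ?z = "fps_const z"
    \<comment> \<open>The brackets on the right start at order 1, so at this order the outer
      \<open>M\<close> contributes only \<mu>.\<close>
    have "fps_nth (B ?x (M ?y ?z)) 1 = fps_nth (M (B ?x ?y) ?z + M ?y (B ?x ?z)) 1"
      unfolding B_def by (subst weakly_associative_derivation[OF wa]) (rule refl)
    then show ?thesis
      by (simp add: B1[simplified] M1[simplified] B0 M0 bilinear_multD[OF bil]
          bilinear_multD[OF bilt])
  qed
  have jacobi: "\<psi> x (\<psi> y z) + \<psi> y (\<psi> z x) + \<psi> z (\<psi> x y) = 0" for x y z
  proof -
    let ?x = "fps_const x" and ?y = "fps_const y" and ?z = "fps_const z"
    \<comment> \<open>By \<open>B0\<close> each inner bracket satisfies the hypothesis of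
      \<open>B2\<close>, and by \<open>B1\<close> its linear coefficient is a value of
      \<psi>.\<close>
    have "fps_nth (B ?x (B ?y ?z) + B ?y (B ?z ?x) + B ?z (B ?x ?y)) 2 = 0"
      unfolding B_def by (subst weakly_associative_jacobi[OF wa]) simp
    then show ?thesis
      by (simp add: B2 B0 B1[simplified])
  qed
  \<comment> \<open>Skew-symmetry moves the derivation from the left slot of \<psi> to the right
    one; the signs cancel.\<close>
  have "\<psi> (\<mu> x y) z = \<mu> x (\<psi> y z) + \<mu> (\<psi> x z) y" for x y z
    using leibniz[of z x y] skew[of "\<mu> x y" z] skew[of z x] skew[of z y]
    by (simp add: bilinear_multD[OF bil])
  moreover have "\<psi> x x = 0" for x
    by (simp add: \<psi>_def skew_part_def)
  ultimately show ?thesis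
    using assms(1,3) bil bil\<psi> jacobi
    unfolding nonassoc_poisson_algebra_def lie_bracket_def \<psi>_def[symmetric] by (intro conjI allI)
qed

end
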